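(* Let $K\subset\mathbb{R}^3$ be a non-degenerate $3$-dimensional unbounded convex polyhedron. Then: (i) If $K$ has facets with non-parallel unbounded edges, then it can be placed in first trimming position with respect to any of them (that is, with respect to any facet that has two non-parallel unbounded edges). (ii) If all the unbounded edges of $K$ are parallel, then $K$ has at least one bounded facet and it can be placed in first trimming position with respect to any of its facets.
   Context: A convex polyhedron in $\mathbb{R}^n$ is a finite intersection of closed affine half-spaces. Its dimension is the dimension of its affine hull. Its faces are its intersections with supporting hyperplanes; facets of an $n$-dimensional polyhedron in $\mathbb{R}^n$ are its $(n-1)$-dimensional faces, edges are $1$-dimensional faces and vertices are $0$-dimensional faces. The polyhedron is non-degenerate if it has at least one vertex. Let $\pi_n:\mathbb{R}^n\to\mathbb{R}^{n-1}\times\{0\}$, $(x_1,\dots,x_n)\mapsto(x_1,\dots,x_{n-1},0)$. For a convex polyhedron $K\subset\mathbb{R}^n$ and $a\in\mathbb{R}^{n-1}$ put $I_a:=\pi_n^{-1}(a,0)\cap K$ (empty or a closed, bounded or unbounded, interval of the line $\pi_n^{-1}(a,0)$), and $\mathfrak{A}_K:=\{a\in\mathbb{R}^{n-1}:\ I_a\neq\varnothing,\ (a,0)\notin I_a\}$. An $n$-dimensional convex polyhedron $K\subset\mathbb{R}^n$ is in first trimming position with respect to its facet $F$ if: (1) $F\subset\{x_{n-1}=0\}$ and $K\subset\{x_{n-1}\le 0\}$; (2) for all $a\in\mathbb{R}^{n-1}$ the interval $I_a$ is bounded; (3) the set $\mathfrak{A}_K$ is bounded. "$K$ can be placed in first trimming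 position with respect to $F$" means that there is an affine change of coordinates (affine bijection) $\phi:\mathbb{R}^n\to\mathbb{R}^n$ such that $\phi(K)$ is in first trimming position with respect to its facet $\phi(F)$. Here $n=3$. *)

theory Defs
  imports "HOL-Analysis.Analysis"
begin

text \<open>
  Convex polyhedra, facets, edges and dimension are the library's \<^const>\<open>polyhedron\<close>,
  \<^const>\<open>facet_of\<close>, \<^const>\<open>edge_of\<close> and \<^const>\<open>aff_dim\<close>. These are built on
  \<^const>\<open>face_of\<close> rather than on intersections with supporting hyperplanes
  (\<^const>\<open>exposed_face_of\<close>); on polyhedra the two notions of face agree, by the library fact
  \<open>exposed_face_of_polyhedron\<close>.
\<close>

definition nondegenerate :: "'a::euclidean_space set \<Rightarrow> bool" where
  "nondegenerate K \<longleftrightarrow> (\<exists>V. V face_of K \<and> aff_dim V = 0)"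

definition unbounded_edge_of :: "'a::euclidean_space set \<Rightarrow> 'a set \<Rightarrow> bool"
    (infixr \<open>(unbounded'_edge'_of)\<close> 50) where
  "e unbounded_edge_of K \<longleftrightarrow> e edge_of K \<and> \<not> bounded e"

definition parallel :: "'a::euclidean_space set \<Rightarrow> 'a set \<Rightarrow> bool" where
  "parallel d e \<longleftrightarrow> affine_parallel (affine hull d) (affine hull e)"

text \<open>
  The point \<open>(a, 0)\<close> of three-space for a point \<open>a\<close> of the plane, and the projection
  \<open>(x\<^sub>1, x\<^sub>2, x\<^sub>3) \<mapsto> (x\<^sub>1, x\<^sub>2, 0)\<close>.
\<close>

definition plane_point :: "real^2 \<Rightarrow> real^3" where
  "plane_point a = vector [a $ 1, a $ 2, 0]"

definition proj_plane :: "real^3 \<Rightarrow> real^3" where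
  "proj_plane x = vector [x $ 1, x $ 2, 0]"

definition fibre :: "(real^3) set \<Rightarrow> real^2 \<Rightarrow> (real^3) set" where
  "fibre K a = proj_plane -` {plane_point a} \<inter> K"

definition missing_set :: "(real^3) set \<Rightarrow> (real^2) set" where
  "missing_set K = {a. fibre K a \<noteq> {} \<and> plane_point a \<notin> fibre K a}"

definition first_trimming_position :: "(real^3) set \<Rightarrow> (real^3) set \<Rightarrow> bool" where
  "first_trimming_position K F \<longleftrightarrow>
     polyhedron K \<and> aff_dim K = 3 \<and> F facet_of K \<and>
     F \<subseteq> {x. x $ 2 = 0} \<and> K \<subseteq> {x. x $ 2 \<le> 0} \<and>
     (\<forall>a. bounded (fibre K a)) \<and>
     bounded (missing_set K)"

definition affine_bijection :: "('a::real_vector \<Rightarrow> 'a) \<Rightarrow> bool" where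
  "affine_bijection \<phi> \<longleftrightarrow> bij \<phi> \<and> (\<exists>f c. linear f \<and> \<phi> = (\<lambda>x. f x + c))"

definition placeable_in_first_trimming_position :: "(real^3) set \<Rightarrow> (real^3) set \<Rightarrow> bool" where
  "placeable_in_first_trimming_position K F \<longleftrightarrow>
     (\<exists>\<phi>. affine_bijection \<phi> \<and> first_trimming_position (\<phi> ` K) (\<phi> ` F))"

end

theory Submission imports Defs
begin

text \<open>
  Let \<open>C\<close> be the recession cone of \<open>K\<close>. A vertex of \<open>K\<close> is exposed, which gives a \<open>g\<close> that is
  positive on \<open>C - {0}\<close>; all sublevel sets of \<open>g\<close> on \<open>K\<close> are bounded. For the facet \<open>F\<close> on
  \<open>n \<bullet> x = c\<close> project along some \<open>w \<noteq> 0\<close> orthogonal to \<open>n\<close> and \<open>g\<close>: neither \<open>w\<close> nor \<open>- w\<close> lies in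
  \<open>C\<close>, so the fibres are bounded. It remains to find a plane, transverse to \<open>w\<close>, whose section of
  \<open>K\<close> has the same projection as \<open>K\<close> up to a bounded set.

  If some \<open>h \<noteq> 0\<close> orthogonal to \<open>w\<close> vanishes on \<open>C\<close>, the projection of \<open>K\<close> is a half-strip, and
  the plane through a minimiser \<open>p\<close> and a maximiser \<open>q\<close> of \<open>h\<close> on \<open>K\<close> with a direction \<open>r \<in> C\<close> works.
  This covers (ii), where \<open>C\<close> is a ray, and (i) if \<open>C\<close> is parallel to \<open>F\<close>. Otherwise in (i) the
  projection is a sector up to a bounded set, with one side below \<open>F\<close> and the other in a direction
  \<open>r \<in> C\<close> that minimises \<open>n \<bullet> r / g \<bullet> r\<close>; since \<open>F\<close> has two independent recession directions
  \<open>u, v\<close>, every line in direction \<open>u + v\<close> in its plane eventually lies in \<open>F\<close>, so the plane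
  through a point of the other side, spanned by \<open>u + v\<close> and \<open>r\<close>, works.

  That \<open>C\<close> is a ray when all unbounded edges are parallel follows by finding unbounded edges whose
  directions attain the minimum and the maximum of a given slope \<open>f \<bullet> d / g \<bullet> d\<close> over \<open>C\<close>.
\<close>

subsection \<open>Recession cones\<close>

text \<open>Asking for the ray from every point makes closure under sums immediate, without
  convexity. The cone of the empty set is the whole space, hence the nonemptiness hypothesis in
  \<open>recession_cone_mono\<close>.\<close>

definition recession_cone :: "'a::real_vector set \<Rightarrow> 'a set" where
  "recession_cone S = {d. \<forall>x\<in>S. \<forall>t\<ge>0. x + t *\<^sub>R d \<in> S}"

lemma recession_coneD:
  "d \<in> recession_cone S \<Longrightarrow> x \<in> S \<Longrightarrow> 0 \<le> t \<Longrightarrow> x + t *\<^sub>R d \<in> S"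
  by (simp add: recession_cone_def)

lemma recession_cone_scale:
  assumes "d \<in> recession_cone S" "0 \<le> c"
  shows "c *\<^sub>R d \<in> recession_cone S"
  using assms unfolding recession_cone_def by simp

lemma recession_cone_add:
  assumes "d \<in> recession_cone S" "e \<in> recession_cone S"
  shows "d + e \<in> recession_cone S"
proof -
  have "x + t *\<^sub>R d + t *\<^sub>R e \<in> S" if "x \<in> S" "0 \<le> t" for x t
    using assms that by (intro recession_coneD) auto
  then show ?thesis
    by (auto simp: recession_cone_def scaleR_add_right add.assoc)
qed

text \<open>For closed convex sets a single ray suffices: \<open>y + t d\<close> is a limit of
  convex combinations of \<open>y\<close>, with weight tending to 1, and points ever farther out on
  the ray from \<open>x\<close>.\<close>

lemma recession_cone_rayI:
  fixes S :: "'a::real_normed_vector set"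
  assumes S: "closed S" "convex S" and x: "x \<in> S" and ray: "\<And>t. 0 \<le> t \<Longrightarrow> x + t *\<^sub>R d \<in> S"
  shows "d \<in> recession_cone S"
proof -
  have "y + t *\<^sub>R d \<in> S" if y: "y \<in> S" and t: "0 \<le> t" for y t
  proof -
    let ?c = "\<lambda>n. inverse (real (Suc n))"
    let ?z = "\<lambda>n. (1 - ?c n) *\<^sub>R y + ?c n *\<^sub>R (x + (real (Suc n) * t) *\<^sub>R d)"
    have c: "?c \<longlonglongrightarrow> 0"
      by (rule LIMSEQ_inverse_real_of_nat)
    have "?z n \<in> S" for n
      using S(2) y ray[of "real (Suc n) * t"] t
      by (intro convexD) (auto simp: field_simps)
    moreover have "?z n = (1 - ?c n) *\<^sub>R y + ?c n *\<^sub>R x + t *\<^sub>R d" for n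
    proof -
      have "?c n * (real (Suc n) * t) = t" by simp
      then show ?thesis
        by (simp only: scaleR_add_right scaleR_scaleR add.assoc)
    qed
    moreover have "(\<lambda>n. (1 - ?c n) *\<^sub>R y + ?c n *\<^sub>R x + t *\<^sub>R d)
        \<longlonglongrightarrow> (1 - 0) *\<^sub>R y + 0 *\<^sub>R x + t *\<^sub>R d"
      by (intro tendsto_intros c)
    ultimately have "?z \<longlonglongrightarrow> y + t *\<^sub>R d" by (simp add: add.assoc)
    with \<open>\<And>n. ?z n \<in> S\<close> show ?thesis by (rule closed_sequentially[OF S(1)])
  qed
  then show ?thesis by (simp add: recession_cone_def)
qed

lemma recession_cone_mono:
  fixes S :: "'a::real_normed_vector set"
  assumes "closed S" "convex S" "T \<subseteq> S" "T \<noteq> {}"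
  shows "recession_cone T \<subseteq> recession_cone S"
proof
  fix d assume d: "d \<in> recession_cone T"
  obtain x where x: "x \<in> T" using assms by auto
  have "x + t *\<^sub>R d \<in> S" if "0 \<le> t" for t
    using recession_coneD[OF d x that] assms(3) by blast
  with x show "d \<in> recession_cone S"
    using assms by (intro recession_cone_rayI[of S x]) auto
qed

lemma closed_recession_cone:
  fixes S :: "'a::real_normed_vector set"
  assumes "closed S"
  shows "closed (recession_cone S)"
proof -
  have eq: "recession_cone S = (\<Inter>x\<in>S. \<Inter>t\<in>{0..}. (\<lambda>d. x + t *\<^sub>R d) -` S)"
    by (auto simp: recession_cone_def)
  show ?thesis unfolding eq
    by (intro closed_INT ballI closed_vimage assms continuous_intros)
qed

text \<open>The unit vectors from a fixed point towards points escaping to infinity accumulate, by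
  compactness of the sphere, at a recession direction.\<close>

lemma unbounded_imp_recession:
  fixes S :: "'a::euclidean_space set"
  assumes S: "closed S" "convex S" "\<not> bounded S"
  obtains d where "d \<in> recession_cone S" "d \<noteq> 0"
proof -
  obtain p where p: "p \<in> S" using S(3) by fastforce
  have "\<exists>x\<in>S. real n < dist p x" for n
    using S(3) unfolding bounded_def by (meson not_le)
  then obtain X where X: "\<And>n. X n \<in> S" "\<And>n. real n < dist p (X n)" by metis
  let ?u = "\<lambda>n. (X n - p) /\<^sub>R dist p (X n)"
  have pos: "0 < dist p (X n)" for n
    using X(2)[of n] by (meson le_less_trans of_nat_0_le_iff)
  have "?u n \<in> sphere 0 1" for n
    using pos[of n] by (simp add: dist_norm norm_minus_commute)
  then have "\<forall>n. ?u n \<in> sphere 0 1" ..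
  then obtain d k where d: "d \<in> sphere 0 1" and k: "strict_mono k" and lim: "(?u \<circ> k) \<longlonglongrightarrow> d"
    using compact_sphere[of "0::'a" 1, unfolded compact_def, THEN spec, of ?u] by blast
  have "p + t *\<^sub>R d \<in> S" if t: "0 \<le> t" for t
  proof (rule closed_sequentially[OF S(1)])
    \<comment> \<open>Shifting the index by \<open>nat \<lceil>t\<rceil>\<close> makes the chosen
      point of \<open>S\<close> farther than \<open>t\<close> from \<open>p\<close>, so each
      \<open>?Y n\<close> lies on a segment within \<open>S\<close>.\<close>
    let ?Y = "\<lambda>n. p + t *\<^sub>R ((?u \<circ> k) (n + nat \<lceil>t\<rceil>))"
    show "?Y \<longlonglongrightarrow> p + t *\<^sub>R d"
      by (intro tendsto_intros LIMSEQ_ignore_initial_segment lim)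
    show "?Y n \<in> S" for n
    proof -
      define m where "m = k (n + nat \<lceil>t\<rceil>)"
      have "n + nat \<lceil>t\<rceil> \<le> m" using k unfolding m_def by (rule seq_suble)
      then have "t \<le> real m" by linarith
      then have c: "t / dist p (X m) \<le> 1"
        using X(2)[of m] pos[of m] by (simp add: divide_simps)
      have "(1 - t / dist p (X m)) *\<^sub>R p + (t / dist p (X m)) *\<^sub>R X m \<in> S"
        using S(2) p X(1)[of m] c t pos[of m] by (intro convexD) auto
      then show ?thesis
        unfolding m_def[symmetric] comp_def
        by (simp add: algebra_simps divide_inverse)
    qed
  qed
  then have "d \<in> recession_cone S" using S p by (intro recession_cone_rayI) auto
  moreover have "d \<noteq> 0" using d by auto
  ultimately show ?thesis by (rule that)
qed

text \<open>If the sublevel set were unbounded, it would have a recession direction of its own,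
  along which \<open>g\<close> would eventually exceed \<open>c\<close>.\<close>

lemma bounded_Int_sublevel:
  fixes S :: "'a::euclidean_space set"
  assumes S: "closed S" "convex S"
    and g: "\<And>d. d \<in> recession_cone S \<Longrightarrow> d \<noteq> 0 \<Longrightarrow> 0 < g \<bullet> d"
  shows "bounded (S \<inter> {x. g \<bullet> x \<le> c})" (is "bounded ?T")
proof (rule ccontr)
  assume unb: "\<not> bounded ?T"
  have "closed ?T" "convex ?T"
    using S by (auto intro: closed_Int closed_halfspace_le convex_Int convex_halfspace_le)
  with unb obtain d where d: "d \<in> recession_cone ?T" "d \<noteq> 0"
    by (metis unbounded_imp_recession)
  have "?T \<noteq> {}" using unb bounded_empty by metis
  then obtain x where x: "x \<in> ?T" by blast
  then have gd: "0 < g \<bullet> d"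
    using d g recession_cone_mono[OF S, of ?T] by blast
  define t where "t = (\<bar>c - g \<bullet> x\<bar> + 1) / (g \<bullet> d)"
  have "x + t *\<^sub>R d \<in> ?T"
    using gd by (intro recession_coneD[OF d(1) x]) (simp add: t_def)
  then have "g \<bullet> x + t * (g \<bullet> d) \<le> c" by (simp add: inner_add_right)
  moreover have "t * (g \<bullet> d) = \<bar>c - g \<bullet> x\<bar> + 1" using gd by (simp add: t_def)
  ultimately show False by linarith
qed

subsection \<open>Linear functionals on pointed polyhedra\<close>

lemma argmin_face_of:
  assumes "convex S" "\<And>y. y \<in> S \<Longrightarrow> f \<bullet> x \<le> f \<bullet> y"
  shows "S \<inter> {y. f \<bullet> y = f \<bullet> x} face_of S"
  using assms by (intro face_of_Int_supporting_hyperplane_ge) auto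

text \<open>Moving from \<open>x\<close> against \<open>d\<close> must leave \<open>S\<close>. The
  last point reached cannot be relatively interior, and the relative frontier of a polyhedron is the
  union of its facets.\<close>

lemma exits_through_facet:
  fixes S :: "'a::euclidean_space set"
  assumes S: "polyhedron S" and x: "x \<in> S"
    and d: "d \<in> recession_cone S" "- d \<notin> recession_cone S"
  obtains t F where "0 \<le> t" "F facet_of S" "x - t *\<^sub>R d \<in> F"
proof -
  have clo: "closed S" and conv: "convex S"
    using S polyhedron_imp_closed polyhedron_imp_convex by auto
  obtain t1 where t1: "0 \<le> t1" "x - t1 *\<^sub>R d \<notin> S"
    using d(2) recession_cone_rayI[OF clo conv x, of "- d"] by auto
  define T where "T = {0..t1} \<inter> (\<lambda>t. x - t *\<^sub>R d) -` S"
  have "compact T" unfolding T_def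
    by (intro compact_Int_closed closed_vimage clo continuous_intros) auto
  moreover have "0 \<in> T" using x t1 by (auto simp: T_def)
  ultimately obtain t where t: "t \<in> T" "\<And>s. s \<in> T \<Longrightarrow> s \<le> t"
    using compact_attains_sup[of T] by auto
  let ?y = "x - t *\<^sub>R d"
  have y: "?y \<in> S" using t by (auto simp: T_def)
  have t0: "0 \<le> t" "t < t1"
    using t t1 by (auto simp: T_def less_le)
  have "?y \<notin> rel_interior S"
  proof
    assume "?y \<in> rel_interior S"
    then obtain e where e: "0 < e" "ball ?y e \<inter> affine hull S \<subseteq> S"
      by (auto simp: mem_rel_interior_ball)
    \<comment> \<open>A further step of this size stays within \<open>t1\<close> and within the
      ball; the \<open>+ 1\<close> avoids a case distinction on \<open>d = 0\<close>.\<close>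
    define \<delta> where "\<delta> = min (t1 - t) (e / (2 * (norm d + 1)))"
    have \<delta>: "0 < \<delta>" using e t0 by (simp add: \<delta>_def add_nonneg_pos)
    have "\<delta> * norm d \<le> e / (2 * (norm d + 1)) * (norm d + 1)"
      using \<delta> e by (intro mult_mono) (auto simp: \<delta>_def)
    also have "\<dots> = e / 2" using norm_ge_zero[of d] by (simp add: divide_simps add_nonneg_eq_0_iff)
    also have "\<dots> < e" using e by simp
    finally have nd: "\<delta> * norm d < e" .
    let ?z = "?y - \<delta> *\<^sub>R d"
    \<comment> \<open>The points \<open>?y\<close> and \<open>?y + d\<close> both lie in
      \<open>S\<close>, so their whole line lies in its affine hull, including points beyond
      \<open>?y\<close>.\<close>
    have y1: "?y + 1 *\<^sub>R d \<in> S" by (rule recession_coneD[OF d(1) y]) simp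
    have "(1 + \<delta>) *\<^sub>R ?y + (- \<delta>) *\<^sub>R (?y + 1 *\<^sub>R d) \<in> affine hull S"
      by (rule mem_affine[OF affine_affine_hull hull_inc[OF y] hull_inc[OF y1]]) simp
    then have "?z \<in> affine hull S" by (simp add: algebra_simps)
    moreover have "?z \<in> ball ?y e" using nd \<delta> by (simp add: dist_norm)
    ultimately have "?z \<in> S" using e by auto
    then have "t + \<delta> \<in> T" using \<delta> t0
      by (auto simp: T_def \<delta>_def algebra_simps)
    then show False using t(2) \<delta> by force
  qed
  then have "?y \<in> rel_frontier S"
    using y clo by (simp add: rel_frontier_def)
  then obtain F where "F facet_of S" "?y \<in> F"
    using rel_frontier_of_polyhedron[OF S] by auto
  with t0 show ?thesis by (intro that)
qed

text \<open>Moving against a recession direction does not increase \<open>f\<close> and ends in a facet, so the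
  minimum over \<open>S\<close> is the smallest of the minima over the facets.\<close>

lemma polyhedron_attains_min:
  fixes S :: "'a::euclidean_space set"
  assumes "polyhedron S" "S \<noteq> {}"
    and "\<And>d. d \<in> recession_cone S \<Longrightarrow> d \<noteq> 0 \<Longrightarrow> 0 < g \<bullet> d"
    and "\<And>d. d \<in> recession_cone S \<Longrightarrow> 0 \<le> f \<bullet> d"
  shows "\<exists>x\<in>S. \<forall>y\<in>S. f \<bullet> x \<le> f \<bullet> y"
  using assms
proof (induction "nat (aff_dim S)" arbitrary: S rule: less_induct)
  case less
  have clo: "closed S" and conv: "convex S"
    using less.prems polyhedron_imp_closed polyhedron_imp_convex by auto
  show ?case
  proof (cases "bounded S")
    case True
    then have "compact S" using clo by (simp add: compact_eq_bounded_closed)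
    then show ?thesis using less.prems(2)
      by (intro continuous_attains_inf continuous_intros)
  next
    case False
    then obtain d where d: "d \<in> recession_cone S" "d \<noteq> 0"
      using clo conv unbounded_imp_recession by blast
    have nd: "- d \<notin> recession_cone S"
      using less.prems(3)[OF d] less.prems(3)[of "- d"] d(2) by force
    have "\<exists>x\<in>F. \<forall>y\<in>F. f \<bullet> x \<le> f \<bullet> y" if F: "F facet_of S" for F
    proof -
      have F': "F \<noteq> {}" "F \<subseteq> S" "aff_dim F = aff_dim S - 1" "polyhedron F"
        using F facet_of_imp_subset face_of_polyhedron_polyhedron[OF less.prems(1)]
        by (auto simp: facet_of_def)
      \<comment> \<open>This makes the dimension of \<open>S\<close> positive, so that the measure
        still drops after truncation by \<open>nat\<close>.\<close>
      have "aff_dim F \<ge> 0" using F'(1) aff_dim_geq[of F] aff_dim_empty[of F] by linarith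
      then have "nat (aff_dim F) < nat (aff_dim S)" using F'(3) by simp
      moreover have "recession_cone F \<subseteq> recession_cone S"
        using recession_cone_mono[OF clo conv] F' by blast
      ultimately show ?thesis
        using less.prems(3,4) F' by (intro less.hyps) auto
    qed
    then obtain m where m: "\<And>F. F facet_of S \<Longrightarrow> m F \<in> F"
      "\<And>F y. F facet_of S \<Longrightarrow> y \<in> F \<Longrightarrow> f \<bullet> m F \<le> f \<bullet> y"
      by metis
    have fin: "finite {F. F facet_of S}"
      using less.prems(1) by (rule finite_polyhedron_facets)
    have ex: "\<exists>F. F facet_of S \<and> f \<bullet> m F \<le> f \<bullet> x" if x: "x \<in> S" for x
    proof -
      obtain t F where t: "0 \<le> t" "F facet_of S" "x - t *\<^sub>R d \<in> F"
        using exits_through_facet[OF less.prems(1) x d(1) nd] by blast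
      have "f \<bullet> m F \<le> f \<bullet> x - t * (f \<bullet> d)"
        using m(2)[OF t(2,3)] by (simp add: inner_diff_right)
      also have "\<dots> \<le> f \<bullet> x" using t(1) less.prems(4)[OF d(1)] by simp
      finally show ?thesis using t(2) by blast
    qed
    obtain F0 where F0: "F0 facet_of S" using ex less.prems(2) by blast
    let ?V = "(\<lambda>F. f \<bullet> m F) ` {F. F facet_of S}"
    have "Min ?V \<in> ?V" using fin F0 by (intro Min_in) auto
    then obtain F where F: "F facet_of S" "f \<bullet> m F = Min ?V" by auto
    have min: "f \<bullet> m F \<le> f \<bullet> m G" if "G facet_of S" for G
      unfolding F(2) using fin that by (intro Min_le) auto
    show ?thesis
    proof (intro bexI ballI)
      show "m F \<in> S" using F(1) m(1) facet_of_imp_subset by blast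
      show "f \<bullet> m F \<le> f \<bullet> y" if "y \<in> S" for y
        using ex[OF that] min by force
    qed
  qed
qed

text \<open>Any \<open>f\<close> becomes nonnegative on the recession cone, and zero on some ray of it, after
  subtracting a suitable multiple of \<open>g\<close>.\<close>

lemma min_slope:
  fixes S :: "'a::euclidean_space set"
  assumes S: "closed S" and c: "c \<in> recession_cone S" "c \<noteq> 0"
    and g: "\<And>d. d \<in> recession_cone S \<Longrightarrow> d \<noteq> 0 \<Longrightarrow> 0 < g \<bullet> d"
  obtains r where "r \<in> recession_cone S" "r \<noteq> 0"
    "\<And>d. d \<in> recession_cone S \<Longrightarrow> f \<bullet> r / (g \<bullet> r) * (g \<bullet> d) \<le> f \<bullet> d"
proof -
  \<comment> \<open>The quotient of \<open>f\<close> and \<open>g\<close> is invariant under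
    positive scaling, so it may be minimised over the compact set of unit recession
    directions.\<close>
  let ?B = "recession_cone S \<inter> sphere 0 1"
  have comp: "compact ?B"
    using closed_recession_cone[OF S] by (intro closed_Int_compact) auto
  have "c /\<^sub>R norm c \<in> ?B" using c by (auto intro!: recession_cone_scale)
  then have ne: "?B \<noteq> {}" by blast
  have gB: "0 < g \<bullet> d" if "d \<in> ?B" for d using g[of d] that by (cases "d = 0") auto
  have "continuous_on ?B (\<lambda>d. (f \<bullet> d) / (g \<bullet> d))"
    using gB by (intro continuous_intros) force
  then obtain r where r: "r \<in> ?B" "\<And>d. d \<in> ?B \<Longrightarrow> f \<bullet> r / (g \<bullet> r) \<le> f \<bullet> d / (g \<bullet> d)"
    using continuous_attains_inf[OF comp ne, of "\<lambda>d. f \<bullet> d / (g \<bullet> d)"] by blast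
  show ?thesis
  proof (rule that)
    show "r \<in> recession_cone S" "r \<noteq> 0" using r by auto
    fix d assume d: "d \<in> recession_cone S"
    show "f \<bullet> r / (g \<bullet> r) * (g \<bullet> d) \<le> f \<bullet> d"
    proof (cases "d = 0")
      case False
      then have "d /\<^sub>R norm d \<in> ?B" using d by (auto intro!: recession_cone_scale)
      from r(2)[OF this] have "f \<bullet> r / (g \<bullet> r) \<le> (f \<bullet> d) / (g \<bullet> d)"
        using False by simp
      then show ?thesis using g[OF d False] by (simp add: pos_le_divide_eq)
    qed simp
  qed
qed

text \<open>With \<open>\<mu>\<close> the least slope, \<open>f - \<mu> g\<close> is nonnegative on
  the cone and zero on some \<open>r\<close>. It therefore attains its minimum on \<open>S\<close>,
  and the face of minimisers contains a ray in direction \<open>r\<close>.\<close>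

lemma min_slope_face:
  fixes S :: "'a::euclidean_space set"
  assumes S: "polyhedron S" "S \<noteq> {}" and c: "c \<in> recession_cone S" "c \<noteq> 0"
    and g: "\<And>d. d \<in> recession_cone S \<Longrightarrow> d \<noteq> 0 \<Longrightarrow> 0 < g \<bullet> d"
  obtains \<mu> b where
    "S \<inter> {x. (f - \<mu> *\<^sub>R g) \<bullet> x = b} face_of S"
    "\<not> bounded (S \<inter> {x. (f - \<mu> *\<^sub>R g) \<bullet> x = b})"
    "\<And>d. d \<in> recession_cone S \<Longrightarrow> \<mu> * (g \<bullet> d) \<le> f \<bullet> d"
proof -
  have clo: "closed S" and conv: "convex S"
    using S polyhedron_imp_closed polyhedron_imp_convex by auto
  obtain r where r: "r \<in> recession_cone S" "r \<noteq> 0"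
    and le: "\<And>d. d \<in> recession_cone S \<Longrightarrow> f \<bullet> r / (g \<bullet> r) * (g \<bullet> d) \<le> f \<bullet> d"
    using min_slope[OF clo c g] by blast
  let ?f = "f - (f \<bullet> r / (g \<bullet> r)) *\<^sub>R g"
  have "0 \<le> ?f \<bullet> d" if "d \<in> recession_cone S" for d
    using le[OF that] by (simp add: inner_diff_left)
  then obtain x where x: "x \<in> S" "\<And>y. y \<in> S \<Longrightarrow> ?f \<bullet> x \<le> ?f \<bullet> y"
    using polyhedron_attains_min[OF S g] by blast
  have fr: "?f \<bullet> r = 0" using g[OF r] by (simp add: inner_diff_left)
  show ?thesis
  proof (rule that[of "f \<bullet> r / (g \<bullet> r)" "?f \<bullet> x"])
    show "S \<inter> {y. ?f \<bullet> y = ?f \<bullet> x} face_of S"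
      using conv x(2) by (rule argmin_face_of)
    show "\<not> bounded (S \<inter> {y. ?f \<bullet> y = ?f \<bullet> x})"
    proof
      assume "bounded (S \<inter> {y. ?f \<bullet> y = ?f \<bullet> x})"
      then obtain M where M: "\<And>y. y \<in> S \<inter> {y. ?f \<bullet> y = ?f \<bullet> x} \<Longrightarrow> norm y \<le> M"
        by (auto simp: bounded_iff)
      define t where "t = (\<bar>M\<bar> + norm x + 1) / norm r"
      have t: "0 \<le> t" "norm (t *\<^sub>R r) = \<bar>M\<bar> + norm x + 1"
        using r by (auto simp: t_def)
      have "x + t *\<^sub>R r \<in> S" using r x t by (intro recession_coneD)
      then have "norm (x + t *\<^sub>R r) \<le> M"
        using fr by (intro M) (simp add: inner_add_right)
      moreover have "norm (t *\<^sub>R r) \<le> norm (x + t *\<^sub>R r) + norm x"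
        by (metis add_diff_cancel_left' norm_triangle_ineq4)
      ultimately show False using t(2) by linarith
    qed
  qed (use le in auto)
qed

lemma recession_cone_Int_hyperplane:
  assumes "d \<in> recession_cone (S \<inter> {x. f \<bullet> x = b})" "x \<in> S \<inter> {x. f \<bullet> x = b}"
  shows "f \<bullet> d = 0"
  using recession_coneD[OF assms, of 1] assms(2) by (simp add: inner_add_right)

subsection \<open>Unbounded edges\<close>

text \<open>Induction on the dimension: a one-dimensional \<open>S\<close> is its own edge;
  otherwise \<open>min_slope_face\<close> yields a proper unbounded face, and edges of a face are
  edges of \<open>S\<close>.\<close>

lemma unbounded_edge_exists:
  fixes S :: "'a::euclidean_space set"
  assumes "polyhedron S" "\<not> bounded S"
    and "\<And>d. d \<in> recession_cone S \<Longrightarrow> d \<noteq> 0 \<Longrightarrow> 0 < g \<bullet> d"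
  shows "\<exists>e. e unbounded_edge_of S"
  using assms
proof (induction "nat (aff_dim S)" arbitrary: S rule: less_induct)
  case less
  have clo: "closed S" and conv: "convex S"
    using less.prems polyhedron_imp_closed polyhedron_imp_convex by auto
  have ne: "S \<noteq> {}" using less.prems(2) bounded_empty by metis
  obtain p where p: "p \<in> S" using ne by blast
  have "aff_dim S \<noteq> 0" using less.prems(2) by (auto simp: aff_dim_eq_0)
  moreover have "aff_dim S \<ge> 0"
    using ne aff_dim_geq[of S] aff_dim_empty[of S] by linarith
  ultimately consider "aff_dim S = 1" | "aff_dim S \<ge> 2" by linarith
  then show ?case
  proof cases
    case 1
    then have "S edge_of S" using conv by (simp add: edge_of_def face_of_refl)
    then show ?thesis using less.prems(2) by (auto simp: unbounded_edge_of_def)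
  next
    case 2
    obtain d where d: "d \<in> recession_cone S" "d \<noteq> 0"
      using clo conv less.prems(2) unbounded_imp_recession by blast
    have gd: "0 < g \<bullet> d" using less.prems(3) d by blast
    have "\<not> S \<subseteq> affine hull {p, p + d}"
    proof
      assume "S \<subseteq> affine hull {p, p + d}"
      then have "aff_dim S \<le> aff_dim {p, p + d}"
        by (metis aff_dim_affine_hull aff_dim_subset)
      then show False using 2 d by simp
    qed
    then obtain x where x: "x \<in> S" "x \<notin> affine hull {p, p + d}" by blast
    \<comment> \<open>Subtracting \<open>k d\<close> moves \<open>x - p\<close> into the kernel of
      \<open>g\<close>. The result \<open>z\<close> is nonzero because \<open>x\<close> is off the
      line through \<open>p\<close> in direction \<open>d\<close>.\<close>
    define k where "k = g \<bullet> (x - p) / (g \<bullet> d)"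
    define z where "z = x - p - k *\<^sub>R d"
    have gz: "g \<bullet> z = 0" using gd by (simp add: z_def k_def inner_diff_right)
    have "z \<noteq> 0"
    proof
      assume "z = 0"
      then have "x = (1 - k) *\<^sub>R p + k *\<^sub>R (p + d)"
        by (simp add: z_def algebra_simps)
      moreover have "1 - k + k = 1" by simp
      ultimately have "x \<in> affine hull {p, p + d}" unfolding affine_hull_2 by blast
      then show False using x by blast
    qed
    obtain \<mu> b where face: "S \<inter> {x. (z - \<mu> *\<^sub>R g) \<bullet> x = b} face_of S"
      and unb: "\<not> bounded (S \<inter> {x. (z - \<mu> *\<^sub>R g) \<bullet> x = b})"
      using min_slope_face[OF less.prems(1) ne d less.prems(3), of z] by blast
    let ?G = "S \<inter> {x. (z - \<mu> *\<^sub>R g) \<bullet> x = b}"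
    \<comment> \<open>If the functional were constant on \<open>S\<close>, it would vanish on
      \<open>x - p\<close> and on \<open>d\<close>, hence on \<open>z\<close>; as \<open>g\<close>
      vanishes on \<open>z\<close>, this would give \<open>z \<bullet> z = 0\<close>.\<close>
    have "?G \<noteq> S"
    proof
      assume eq: "?G = S"
      then have const: "(z - \<mu> *\<^sub>R g) \<bullet> y = b" if "y \<in> S" for y using that by blast
      have "(z - \<mu> *\<^sub>R g) \<bullet> d = 0"
        using recession_cone_Int_hyperplane[of d S "z - \<mu> *\<^sub>R g" b p] d(1) p eq by simp
      then have "(z - \<mu> *\<^sub>R g) \<bullet> z = 0"
        using const[OF x(1)] const[OF p] by (simp add: z_def inner_diff_right)
      then show False using gz \<open>z \<noteq> 0\<close> by (simp add: inner_diff_left)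
    qed
    have "aff_dim ?G < aff_dim S"
      using face_of_aff_dim_lt[OF conv face \<open>?G \<noteq> S\<close>] .
    then have "nat (aff_dim ?G) < nat (aff_dim S)" using 2 by linarith
    moreover have "polyhedron ?G" using face less.prems(1) face_of_polyhedron_polyhedron by blast
    moreover have "?G \<noteq> {}" using unb bounded_empty by metis
    then have "recession_cone ?G \<subseteq> recession_cone S"
      using recession_cone_mono[OF clo conv, of ?G] by blast
    ultimately obtain e where "e unbounded_edge_of ?G"
      using less.hyps[of ?G] unb less.prems(3) by blast
    then have "e unbounded_edge_of S"
      using face by (auto simp: unbounded_edge_of_def edge_of_def intro: face_of_trans)
    then show ?thesis by blast
  qed
qed

section \<open>Directions of unbounded edges and parallelism\<close>

lemma affine_hull_edge:
  fixes e :: "'a::euclidean_space set"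
  assumes "aff_dim e = 1" "p \<in> e" "p + u \<in> e" "u \<noteq> 0"
  shows "affine hull e = range (\<lambda>t. p + t *\<^sub>R u)"
proof -
  have "affine hull {p, p + u} = affine hull e"
  proof (rule affine_dim_equal)
    show "affine hull {p, p + u} \<subseteq> affine hull e"
      using assms by (intro hull_mono) auto
    show "aff_dim (affine hull {p, p + u}) = aff_dim (affine hull e)"
      using assms by (simp add: aff_dim_affine_hull)
  qed auto
  moreover have "affine hull {p, p + u} = range (\<lambda>t. p + t *\<^sub>R u)"
  proof -
    have "a *\<^sub>R p + v *\<^sub>R (p + u) = p + v *\<^sub>R u" if "a + v = 1" for a v :: real
      using that by (simp add: scaleR_add_right flip: add.assoc scaleR_add_left)
    then show ?thesis
      unfolding affine_hull_2 by (auto simp: image_iff) (metis diff_add_cancel)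
  qed
  ultimately show ?thesis by simp
qed

text \<open>This turns \<open>parallel\<close> into proportionality of recession directions. The
  affine hulls are the lines through the edges in those directions, and a translation preserves
  differences of points.\<close>

lemma parallel_iff_recession:
  fixes d e :: "'a::euclidean_space set"
  assumes "aff_dim d = 1" "u \<in> recession_cone d" "u \<noteq> 0"
    and "aff_dim e = 1" "v \<in> recession_cone e" "v \<noteq> 0"
  shows "parallel d e \<longleftrightarrow> (\<exists>k. v = k *\<^sub>R u)"
proof -
  obtain p q where pq: "p \<in> d" "q \<in> e"
    using assms(1,4) by fastforce
  have hull: "affine hull d = range (\<lambda>t. p + t *\<^sub>R u)" "affine hull e = range (\<lambda>t. q + t *\<^sub>R v)"
    using affine_hull_edge[OF assms(1) pq(1) _ assms(3)] affine_hull_edge[OF assms(4) pq(2) _ assms(6)]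
      recession_coneD[OF assms(2) pq(1), of 1] recession_coneD[OF assms(5) pq(2), of 1] by auto
  show ?thesis
  proof
    assume "parallel d e"
    then obtain a where a: "range (\<lambda>t. q + t *\<^sub>R v) = (+) a ` range (\<lambda>t. p + t *\<^sub>R u)"
      unfolding parallel_def affine_parallel_def hull by blast
    have "\<exists>t'. q + t *\<^sub>R v = a + (p + t' *\<^sub>R u)" for t
    proof -
      have "q + t *\<^sub>R v \<in> (+) a ` range (\<lambda>t. p + t *\<^sub>R u)" unfolding a[symmetric] by blast
      then show ?thesis by auto
    qed
    from this[of 0] this[of 1] obtain t0 t1
      where t: "q + 0 *\<^sub>R v = a + (p + t0 *\<^sub>R u)" "q + 1 *\<^sub>R v = a + (p + t1 *\<^sub>R u)" by blast
    have "v = (q + 1 *\<^sub>R v) - (q + 0 *\<^sub>R v)" by simp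
    also have "\<dots> = (t1 - t0) *\<^sub>R u" unfolding t by (simp add: algebra_simps)
    finally have "v = (t1 - t0) *\<^sub>R u" .
    then show "\<exists>k. v = k *\<^sub>R u" ..
  next
    assume "\<exists>k. v = k *\<^sub>R u"
    then obtain k where k: "v = k *\<^sub>R u" ..
    then have "k \<noteq> 0" using assms(6) by auto
    have "range (\<lambda>t. q + t *\<^sub>R v) = (+) (q - p) ` range (\<lambda>t. p + t *\<^sub>R u)"
    proof (rule set_eqI iffI)+
      fix x assume "x \<in> range (\<lambda>t. q + t *\<^sub>R v)"
      then obtain t where "x = q + t *\<^sub>R v" by auto
      then have "x = (q - p) + (p + (t * k) *\<^sub>R u)" by (simp add: k)
      then show "x \<in> (+) (q - p) ` range (\<lambda>t. p + t *\<^sub>R u)" by blast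
    next
      fix x assume "x \<in> (+) (q - p) ` range (\<lambda>t. p + t *\<^sub>R u)"
      then obtain t where "x = (q - p) + (p + t *\<^sub>R u)" by blast
      then have "x = q + (t / k) *\<^sub>R v" using \<open>k \<noteq> 0\<close> by (simp add: k)
      then show "x \<in> range (\<lambda>t. q + t *\<^sub>R v)" by blast
    qed
    then show "parallel d e"
      unfolding parallel_def affine_parallel_def hull by blast
  qed
qed

lemma unbounded_edge_recession:
  fixes S :: "'a::euclidean_space set"
  assumes S: "polyhedron S" and e: "e unbounded_edge_of S"
  obtains u where "u \<in> recession_cone e" "u \<in> recession_cone S" "u \<noteq> 0" "aff_dim e = 1"
proof -
  have face: "e face_of S" and unb: "\<not> bounded e" and dim: "aff_dim e = 1"
    using e by (auto simp: unbounded_edge_of_def edge_of_def)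
  have pe: "polyhedron e" using S face by (rule face_of_polyhedron_polyhedron)
  then obtain u where u: "u \<in> recession_cone e" "u \<noteq> 0"
    using unb unbounded_imp_recession polyhedron_imp_closed polyhedron_imp_convex by blast
  have "e \<noteq> {}" using unb bounded_empty by metis
  then have "u \<in> recession_cone S"
    using recession_cone_mono[OF polyhedron_imp_closed[OF S] polyhedron_imp_convex[OF S]
        face_of_imp_subset[OF face]] u(1) by blast
  with u dim show ?thesis by (intro that)
qed

text \<open>Let \<open>a \<bullet> x = b\<close> expose a vertex \<open>v\<close>. A recession
  direction cannot increase \<open>a\<close> from \<open>v\<close>, and cannot keep it constant
  without staying in \<open>{v}\<close>; so \<open>- a\<close> works.\<close>

lemma pointed_functional:
  fixes S :: "'a::euclidean_space set"
  assumes S: "polyhedron S" "nondegenerate S"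
  obtains g where "\<And>d. d \<in> recession_cone S \<Longrightarrow> d \<noteq> 0 \<Longrightarrow> 0 < g \<bullet> d"
proof -
  obtain v where v: "{v} face_of S"
    using S(2) by (auto simp: nondegenerate_def aff_dim_eq_0)
  then obtain a b where ab: "S \<subseteq> {x. a \<bullet> x \<le> b}" "{v} = S \<inter> {x. a \<bullet> x = b}"
    using exposed_face_of_polyhedron[OF S(1), of "{v}"] unfolding exposed_face_of_def by blast
  show ?thesis
  proof (rule that[of "- a"])
    fix d assume d: "d \<in> recession_cone S" "d \<noteq> 0"
    have "v \<in> S" and av: "a \<bullet> v = b" using ab(2) by auto
    then have vd: "v + 1 *\<^sub>R d \<in> S" using d by (intro recession_coneD) auto
    then have "a \<bullet> d \<le> 0" using ab(1) av by (auto simp: inner_add_right)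
    moreover have "a \<bullet> d \<noteq> 0"
    proof
      assume "a \<bullet> d = 0"
      then have "v + d \<in> {v}" unfolding ab(2) using vd av by (simp add: inner_add_right)
      then show False using d by simp
    qed
    ultimately show "0 < - a \<bullet> d" by simp
  qed
qed

text \<open>Minimal and maximal slopes of any \<open>f\<close> relative to \<open>g\<close> are
  attained by unbounded edges. Parallel edges have equal slopes, so every slope function is constant
  on the cone; a suitable \<open>f\<close> then identifies the rays of \<open>u\<close> and
  \<open>v\<close>.\<close>

lemma recession_ray_if_edges_parallel:
  fixes S :: "'a::euclidean_space set"
  assumes S: "polyhedron S" "S \<noteq> {}"
    and g: "\<And>d. d \<in> recession_cone S \<Longrightarrow> d \<noteq> 0 \<Longrightarrow> 0 < g \<bullet> d"
    and par: "\<And>d e. d unbounded_edge_of S \<Longrightarrow> e unbounded_edge_of S \<Longrightarrow> parallel d e"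
    and u: "u \<in> recession_cone S" "u \<noteq> 0" and v: "v \<in> recession_cone S"
  shows "\<exists>k. v = k *\<^sub>R u"
proof (cases "v = 0")
  case True
  then have "v = 0 *\<^sub>R u" by simp
  then show ?thesis ..
next
  case False
  have clo: "closed S" and conv: "convex S"
    using S polyhedron_imp_closed polyhedron_imp_convex by auto
  \<comment> \<open>An unbounded edge of the face of minimal slope has a direction of slope exactly
    \<open>\<mu>\<close>. Applied to \<open>- f\<close>, this gives the maximal slope.\<close>
  have extremal: "\<exists>\<mu> e d. e unbounded_edge_of S \<and> d \<in> recession_cone e \<and> d \<noteq> 0 \<and> aff_dim e = 1 \<and>
      f \<bullet> d = \<mu> * (g \<bullet> d) \<and> 0 < g \<bullet> d \<and> (\<forall>c\<in>recession_cone S. \<mu> * (g \<bullet> c) \<le> f \<bullet> c)" for f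
  proof -
    obtain \<mu> b where face: "S \<inter> {x. (f - \<mu> *\<^sub>R g) \<bullet> x = b} face_of S"
      and unb: "\<not> bounded (S \<inter> {x. (f - \<mu> *\<^sub>R g) \<bullet> x = b})"
      and le: "\<And>d. d \<in> recession_cone S \<Longrightarrow> \<mu> * (g \<bullet> d) \<le> f \<bullet> d"
      using min_slope_face[OF S u g, of f] by blast
    let ?G = "S \<inter> {x. (f - \<mu> *\<^sub>R g) \<bullet> x = b}"
    have pG: "polyhedron ?G" using face S(1) face_of_polyhedron_polyhedron by blast
    have ne: "?G \<noteq> {}" using unb bounded_empty by metis
    then have sub: "recession_cone ?G \<subseteq> recession_cone S"
      using recession_cone_mono[OF clo conv, of ?G] by blast
    then obtain e where e: "e unbounded_edge_of ?G"
      using unbounded_edge_exists[OF pG unb, of g] g by blast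
    obtain d where d: "d \<in> recession_cone e" "d \<in> recession_cone ?G" "d \<noteq> 0" "aff_dim e = 1"
      using unbounded_edge_recession[OF pG e] .
    have "(f - \<mu> *\<^sub>R g) \<bullet> d = 0" using recession_cone_Int_hyperplane[OF d(2)] ne by blast
    then have "f \<bullet> d = \<mu> * (g \<bullet> d)" by (simp add: inner_diff_left)
    moreover have "e unbounded_edge_of S"
      using e face by (auto simp: unbounded_edge_of_def edge_of_def intro: face_of_trans)
    moreover have "0 < g \<bullet> d" using g d sub by blast
    ultimately show ?thesis using d le by blast
  qed
  have gu: "0 < g \<bullet> u" and gv: "0 < g \<bullet> v" using g u v False by auto
  \<comment> \<open>After scaling \<open>u\<close> and \<open>v\<close> to \<open>g\<close>-value 1,
    \<open>f\<close> is their difference, so its slopes at \<open>u\<close> and \<open>v\<close>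
    differ by exactly \<open>f \<bullet> f\<close>.\<close>
  define f where "f = u /\<^sub>R (g \<bullet> u) - v /\<^sub>R (g \<bullet> v)"
  obtain \<mu> e d where 1: "e unbounded_edge_of S" "d \<in> recession_cone e" "d \<noteq> 0" "aff_dim e = 1"
    "f \<bullet> d = \<mu> * (g \<bullet> d)" "0 < g \<bullet> d" "\<And>c. c \<in> recession_cone S \<Longrightarrow> \<mu> * (g \<bullet> c) \<le> f \<bullet> c"
    using extremal[of f] by blast
  obtain \<nu> e' d' where 2: "e' unbounded_edge_of S" "d' \<in> recession_cone e'" "d' \<noteq> 0" "aff_dim e' = 1"
    "- f \<bullet> d' = \<nu> * (g \<bullet> d')" "0 < g \<bullet> d'" "\<And>c. c \<in> recession_cone S \<Longrightarrow> \<nu> * (g \<bullet> c) \<le> - f \<bullet> c"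
    using extremal[of "- f"] by blast
  obtain k where k: "d' = k *\<^sub>R d"
    using parallel_iff_recession[OF 1(4,2,3) 2(4,2,3)] par[OF 1(1) 2(1)] by blast
  have "k \<noteq> 0" using k 2(3) by auto
  \<comment> \<open>Proportional directions have the same slope, so the minimal and maximal slopes
    of \<open>f\<close> coincide.\<close>
  have "(\<mu> + \<nu>) * (k * (g \<bullet> d)) = 0"
    using 1(5) 2(5) unfolding k by (simp add: algebra_simps)
  then have \<nu>: "\<nu> = - \<mu>" using \<open>k \<noteq> 0\<close> 1(6) by auto
  have "\<mu> \<le> f \<bullet> v / (g \<bullet> v)" "f \<bullet> u / (g \<bullet> u) \<le> \<mu>"
    using 1(7)[OF v] 2(7)[OF u(1)] gu gv \<nu> by (simp_all add: field_simps)
  moreover have "f \<bullet> f = f \<bullet> u / (g \<bullet> u) - f \<bullet> v / (g \<bullet> v)"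
    by (subst (2) f_def) (simp add: inner_diff_right divide_inverse_commute)
  ultimately have "f \<bullet> f \<le> 0" by linarith
  then have "f = 0" by (metis inner_gt_zero_iff not_le)
  then have "u /\<^sub>R (g \<bullet> u) = v /\<^sub>R (g \<bullet> v)" by (simp add: f_def)
  moreover have "v = (g \<bullet> v) *\<^sub>R (v /\<^sub>R (g \<bullet> v))" using gv by simp
  ultimately have "v = (g \<bullet> v) *\<^sub>R (u /\<^sub>R (g \<bullet> u))" by simp
  then have "v = (g \<bullet> v * inverse (g \<bullet> u)) *\<^sub>R u" by simp
  then show ?thesis ..
qed

text \<open>From a relative interior point move in direction \<open>- r\<close> until reaching a facet; if that facet
  were unbounded, \<open>r\<close> would be a recession direction of it and the starting point would lie in it.\<close>

lemma bounded_facet_exists: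
  fixes S :: "'a::euclidean_space set"
  assumes S: "polyhedron S" "S \<noteq> {}"
    and g: "\<And>d. d \<in> recession_cone S \<Longrightarrow> d \<noteq> 0 \<Longrightarrow> 0 < g \<bullet> d"
    and r: "r \<in> recession_cone S" "r \<noteq> 0"
    and ray: "\<And>v. v \<in> recession_cone S \<Longrightarrow> \<exists>k. v = k *\<^sub>R r"
  shows "\<exists>F. F facet_of S \<and> bounded F"
proof (rule ccontr)
  assume no: "\<not> (\<exists>F. F facet_of S \<and> bounded F)"
  have clo: "closed S" and conv: "convex S"
    using S polyhedron_imp_closed polyhedron_imp_convex by auto
  obtain x where x: "x \<in> rel_interior S"
    using S(2) conv rel_interior_eq_empty by blast
  have "- r \<notin> recession_cone S" using g[OF r] g[of "- r"] r(2) by force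
  then obtain t F where F: "0 \<le> t" "F facet_of S" "x - t *\<^sub>R r \<in> F"
    using exits_through_facet[OF S(1) _ r(1)] x rel_interior_subset by blast
  have face: "F face_of S" using F(2) by (rule facet_of_imp_face_of)
  have "F \<subseteq> S" using face by (rule face_of_imp_subset)
  have "F \<noteq> {}" using F(2) by (simp add: facet_of_def)
  have "polyhedron F" using S(1) face by (rule face_of_polyhedron_polyhedron)
  moreover have "\<not> bounded F" using no F(2) by blast
  ultimately obtain d where d: "d \<in> recession_cone F" "d \<noteq> 0"
    using unbounded_imp_recession polyhedron_imp_closed polyhedron_imp_convex by blast
  have dS: "d \<in> recession_cone S"
    using d recession_cone_mono[OF clo conv \<open>F \<subseteq> S\<close> \<open>F \<noteq> {}\<close>] by blast
  then obtain k where k: "d = k *\<^sub>R r" using ray by blast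
  \<comment> \<open>Both \<open>d\<close> and \<open>r\<close> have positive \<open>g\<close>-value,
    which excludes opposite directions.\<close>
  have "0 < k"
    using g[OF dS d(2)] g[OF r] by (simp add: k zero_less_mult_iff)
  then have "r = (1 / k) *\<^sub>R d" by (simp add: k)
  then have "r \<in> recession_cone F" using d \<open>0 < k\<close> by (metis recession_cone_scale less_imp_le zero_less_divide_1_iff)
  from recession_coneD[OF this F(3,1)] have "x \<in> F" by simp
  then have "x \<in> rel_frontier S" using F(2) rel_frontier_of_polyhedron[OF S(1)] by blast
  then show False using x by (simp add: rel_frontier_def)
qed

subsection \<open>Placing a polyhedron\<close>

lemma polyhedron_translation:
  fixes S :: "'a::euclidean_space set"
  assumes "polyhedron S"
  shows "polyhedron ((+) a ` S)"
proof -
  obtain F where F: "finite F" "S = \<Inter>F" "\<And>h. h \<in> F \<Longrightarrow> \<exists>n b. n \<noteq> 0 \<and> h = {x. n \<bullet> x \<le> b}"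
    using assms unfolding polyhedron_def by blast
  have mem: "x \<in> (+) a ` X \<longleftrightarrow> x - a \<in> X" for x X
    by (metis add_diff_cancel_left' diff_add_cancel add.commute image_iff)
  have "polyhedron ((+) a ` h)" if hF: "h \<in> F" for h
  proof -
    obtain n b where h: "h = {x. n \<bullet> x \<le> b}" using F(3)[OF hF] by blast
    have "(+) a ` h = {x. n \<bullet> x \<le> b + n \<bullet> a}"
      by (rule set_eqI) (simp only: mem h mem_Collect_eq inner_diff_right diff_le_eq)
    then show ?thesis by (simp add: polyhedron_halfspace_le)
  qed
  then have "polyhedron (\<Inter>((`) ((+) a) ` F))" using F(1) by (intro polyhedron_Inter) auto
  moreover have "(+) a ` S = \<Inter>((`) ((+) a) ` F)"
    unfolding F(2) by (rule set_eqI) (simp only: mem Inter_iff ball_simps)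
  ultimately show ?thesis by simp
qed

text \<open>An injective linear endomorphism is surjective. Independence is stated through
  coefficients so that it can be checked by applying functionals one at a time.\<close>

lemma basis3_coordinates:
  fixes x :: "real^3"
  assumes indep: "\<And>\<alpha> \<beta> \<gamma>. \<alpha> *\<^sub>R s + \<beta> *\<^sub>R r + \<gamma> *\<^sub>R w = 0 \<Longrightarrow> \<alpha> = 0 \<and> \<beta> = 0 \<and> \<gamma> = 0"
  obtains \<alpha> \<beta> \<gamma> where "x = \<alpha> *\<^sub>R s + \<beta> *\<^sub>R r + \<gamma> *\<^sub>R w"
proof -
  define L where "L = (\<lambda>v::real^3. v $ 1 *\<^sub>R s + v $ 2 *\<^sub>R r + v $ 3 *\<^sub>R w)"
  have "linear L" by (rule linearI) (simp_all add: L_def algebra_simps)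
  moreover have "inj L"
    unfolding linear_injective_0[OF \<open>linear L\<close>]
  proof (intro allI impI)
    fix v assume "L v = 0"
    then have "v $ 1 = 0 \<and> v $ 2 = 0 \<and> v $ 3 = 0" unfolding L_def by (rule indep)
    then show "v = 0" by (simp add: vec_eq_iff forall_3)
  qed
  ultimately have "surj L" by (rule linear_inj_imp_surj)
  then obtain v where "x = L v" by blast
  then show ?thesis by (intro that) (simp add: L_def)
qed

text \<open>The coordinates are \<open>(w \<times> n) \<bullet> x\<close>, \<open>n \<bullet> x - c\<close> and \<open>(s \<times> r) \<bullet> (x - q)\<close>: the last axis is \<open>w\<close>,
  and the plane \<open>x\<^sub>3 = 0\<close> is \<open>q + span {s, r}\<close>.\<close>

lemma placeable_criterion:
  fixes K F S :: "(real^3) set" and n w s r q :: "real^3"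
  assumes K: "polyhedron K" "aff_dim K = 3" and F: "F facet_of K"
    and n: "n \<noteq> 0" "F \<subseteq> {x. n \<bullet> x = c}" "K \<subseteq> {x. n \<bullet> x \<le> c}" and nw: "n \<bullet> w = 0"
    and indep: "\<And>\<alpha> \<beta> \<gamma>. \<alpha> *\<^sub>R s + \<beta> *\<^sub>R r + \<gamma> *\<^sub>R w = 0 \<Longrightarrow> \<alpha> = 0 \<and> \<beta> = 0 \<and> \<gamma> = 0"
    and fibres: "\<And>x. bounded (K \<inter> range (\<lambda>t. x + t *\<^sub>R w))"
    and S: "bounded S"
    and shift: "\<And>\<alpha> \<beta> \<gamma>. q + (\<alpha> *\<^sub>R s + \<beta> *\<^sub>R r + \<gamma> *\<^sub>R w) \<in> K - S \<Longrightarrow> q + (\<alpha> *\<^sub>R s + \<beta> *\<^sub>R r) \<in> K"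
  shows "placeable_in_first_trimming_position K F"
proof -
  have w0: "w \<noteq> 0" using indep[of 0 0 1] by auto
  define m where "m = cross3 w n"
  have m: "m \<bullet> w = 0" "m \<bullet> n = 0" by (simp_all add: m_def dot_cross_self)
  have m0: "m \<noteq> 0"
    using norm_and_cross_eq_0[of w n] n(1) w0 nw by (simp add: m_def inner_commute)
  define b where "b = cross3 s r"
  have b: "b \<bullet> s = 0" "b \<bullet> r = 0" by (simp_all add: b_def dot_cross_self)
  have "b \<noteq> 0"
  proof
    assume "b = 0"
    then have "s = 0 \<or> r = 0 \<or> (\<exists>k. r = k *\<^sub>R s)"
      by (simp add: b_def cross_eq_0 collinear_lemma)
    then show False using indep[of 1 0 0] indep[of 0 1 0] indep[of k "-1" 0 for k] by force
  qed
  \<comment> \<open>Since \<open>b\<close> is orthogonal to \<open>s\<close> and \<open>r\<close>,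
    orthogonality to \<open>w\<close> as well would make it orthogonal to itself.\<close>
  have bw: "b \<bullet> w \<noteq> 0"
  proof
    assume 0: "b \<bullet> w = 0"
    obtain \<alpha> \<beta> \<gamma> where "b = \<alpha> *\<^sub>R s + \<beta> *\<^sub>R r + \<gamma> *\<^sub>R w" using basis3_coordinates[OF indep] .
    then have "b \<bullet> b = b \<bullet> (\<alpha> *\<^sub>R s + \<beta> *\<^sub>R r + \<gamma> *\<^sub>R w)" by simp
    then have "b \<bullet> b = 0" by (simp add: inner_add_right 0 b)
    with \<open>b \<noteq> 0\<close> show False by simp
  qed
  define f where "f = (\<lambda>x. vector [m \<bullet> x, n \<bullet> x, b \<bullet> x] :: real^3)"
  define k where "k = (vector [0, - c, - (b \<bullet> q)] :: real^3)"
  define \<phi> where "\<phi> = (\<lambda>x. f x + k)"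
  have fc: "f x $ 1 = m \<bullet> x" "f x $ 2 = n \<bullet> x" "f x $ 3 = b \<bullet> x" for x
    by (simp_all add: f_def)
  have \<phi>c: "\<phi> x $ 1 = m \<bullet> x" "\<phi> x $ 2 = n \<bullet> x - c" "\<phi> x $ 3 = b \<bullet> (x - q)" for x
    by (simp_all add: \<phi>_def fc k_def inner_diff_right)
  \<comment> \<open>The vectors \<open>m\<close> and \<open>n\<close> span the orthogonal complement
    of \<open>w\<close>. Concretely, the part \<open>y\<close> of \<open>x\<close> orthogonal to
    \<open>w\<close> has zero inner and cross product with \<open>m\<close>.\<close>
  have line: "\<exists>t. x = t *\<^sub>R w" if "m \<bullet> x = 0" "n \<bullet> x = 0" for x
  proof -
    define y where "y = x - (x \<bullet> w / (w \<bullet> w)) *\<^sub>R w"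
    have y: "m \<bullet> y = 0" "n \<bullet> y = 0" "w \<bullet> y = 0"
      using that m nw w0 by (simp_all add: y_def inner_diff_right inner_commute)
    have "cross3 m y = 0"
    proof -
      have "cross3 m y = (w \<bullet> y) *\<^sub>R n - (n \<bullet> y) *\<^sub>R w"
        by (simp add: m_def cross3_simps forall_3)
      then show ?thesis using y by simp
    qed
    then have "y = 0"
      using norm_and_cross_eq_0[of m y] m0 y(1) by simp
    then show ?thesis by (auto simp: y_def)
  qed
  have lin: "linear f"
    by (rule linearI) (simp_all add: vec_eq_iff forall_3 fc inner_add_right)
  have inj: "inj f"
    unfolding linear_injective_0[OF lin]
  proof (intro allI impI)
    fix x assume "f x = 0"
    then have x: "m \<bullet> x = 0" "n \<bullet> x = 0" "b \<bullet> x = 0"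
      by (simp_all add: fc flip: fc(1) fc(2) fc(3))
    then obtain t where "x = t *\<^sub>R w" using line by blast
    then show "x = 0" using x(3) bw by simp
  qed
  have bij: "bij f" using inj linear_inj_imp_surj[OF lin inj] by (simp add: bij_def)
  have img: "\<phi> ` X = (+) k ` f ` X" for X by (auto simp: \<phi>_def image_iff add.commute)
  have "bij \<phi>"
  proof -
    have "\<phi> = (+) k \<circ> f" by (auto simp: \<phi>_def add.commute)
    then show ?thesis using bij by (metis bij_comp bij_plus)
  qed
  then have "affine_bijection \<phi>" using lin unfolding affine_bijection_def \<phi>_def by blast
  moreover have "first_trimming_position (\<phi> ` K) (\<phi> ` F)"
    unfolding first_trimming_position_def
  proof (intro conjI allI)
    show "polyhedron (\<phi> ` K)"
      unfolding img using K(1) polyhedron_linear_image_eq[OF lin bij] polyhedron_translation by blast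
    show "aff_dim (\<phi> ` K) = 3"
      unfolding img using K(2) lin inj by (simp add: aff_dim_translation_eq)
    show "\<phi> ` F facet_of \<phi> ` K"
      unfolding img facet_of_def using F lin inj
      by (simp add: aff_dim_translation_eq face_of_translation_eq face_of_linear_image facet_of_def)
    show "\<phi> ` F \<subseteq> {x. x $ 2 = 0}" using n by (auto simp: \<phi>c)
    show "\<phi> ` K \<subseteq> {x. x $ 2 \<le> 0}" using n by (auto simp: \<phi>c)
    \<comment> \<open>Points of one fibre agree in the first two coordinates, so they come from a
      single line in direction \<open>w\<close>.\<close>
    show "bounded (fibre (\<phi> ` K) a)" for a
    proof (cases "fibre (\<phi> ` K) a = {}")
      case False
      have in_fibre: "m \<bullet> x = a $ 1 \<and> n \<bullet> x - c = a $ 2" if "\<phi> x \<in> fibre (\<phi> ` K) a" for x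
        using that by (auto simp: fibre_def proj_plane_def plane_point_def vec_eq_iff forall_3 \<phi>c)
      obtain x0 where x0: "\<phi> x0 \<in> fibre (\<phi> ` K) a"
        using False by (auto simp: fibre_def)
      have "fibre (\<phi> ` K) a \<subseteq> (+) k ` f ` (K \<inter> range (\<lambda>t. x0 + t *\<^sub>R w))"
      proof
        fix y assume y: "y \<in> fibre (\<phi> ` K) a"
        then obtain x where x: "x \<in> K" "y = \<phi> x" by (auto simp: fibre_def)
        have "\<exists>t. x - x0 = t *\<^sub>R w"
          using in_fibre[of x] in_fibre[OF x0] y x by (intro line) (auto simp: inner_diff_right)
        then obtain t where "x - x0 = t *\<^sub>R w" ..
        then have "x = x0 + t *\<^sub>R w" by (simp add: algebra_simps)
        then have "x \<in> K \<inter> range (\<lambda>t. x0 + t *\<^sub>R w)" using x by blast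
        then show "y \<in> (+) k ` f ` (K \<inter> range (\<lambda>t. x0 + t *\<^sub>R w))"
          unfolding img[symmetric] x(2) by (rule imageI)
      qed
      moreover have "bounded ((+) k ` f ` (K \<inter> range (\<lambda>t. x0 + t *\<^sub>R w)))"
        using fibres lin by (intro bounded_translation bounded_linear_image) (simp_all add: linear_conv_bounded_linear)
      ultimately show ?thesis by (rule bounded_subset[rotated])
    qed simp
    show "bounded (missing_set (\<phi> ` K))"
    proof -
      \<comment> \<open>Forgetting the third coordinate, the missing set is covered by the shadow of
        \<open>S\<close>: over any point outside \<open>S\<close>, \<open>shift\<close> supplies a
        point of \<open>K\<close> on the plane that becomes \<open>x\<^sub>3 = 0\<close>.\<close>
      define h where "h = (\<lambda>y::real^3. vector [y $ 1, y $ 2] :: real^2)"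
      have "linear h" by (rule linearI) (simp_all add: h_def vec_eq_iff forall_2)
      have "missing_set (\<phi> ` K) \<subseteq> h ` (+) k ` f ` S"
      proof
        fix a assume a: "a \<in> missing_set (\<phi> ` K)"
        then obtain x where x: "x \<in> K" "m \<bullet> x = a $ 1" "n \<bullet> x - c = a $ 2"
          by (auto simp: missing_set_def fibre_def proj_plane_def plane_point_def vec_eq_iff forall_3 \<phi>c)
        have notin: "plane_point a \<notin> \<phi> ` K"
          using a by (auto simp: missing_set_def fibre_def proj_plane_def plane_point_def vec_eq_iff forall_3)
        have "x \<in> S"
        proof (rule ccontr)
          assume "x \<notin> S"
          obtain \<alpha> \<beta> \<gamma> where "x - q = \<alpha> *\<^sub>R s + \<beta> *\<^sub>R r + \<gamma> *\<^sub>R w"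
            using basis3_coordinates[OF indep] .
          then have xe: "x = q + (\<alpha> *\<^sub>R s + \<beta> *\<^sub>R r + \<gamma> *\<^sub>R w)" by (simp add: algebra_simps)
          define y where "y = q + (\<alpha> *\<^sub>R s + \<beta> *\<^sub>R r)"
          have yx: "y = x - \<gamma> *\<^sub>R w" by (simp add: xe y_def)
          have "y \<in> K" using shift[of \<alpha> \<beta> \<gamma>] x(1) \<open>x \<notin> S\<close> by (simp add: xe y_def)
          moreover have "b \<bullet> (y - q) = 0" by (simp add: y_def inner_add_right b)
          then have "\<phi> y = plane_point a"
            using x nw m by (simp add: vec_eq_iff forall_3 \<phi>c plane_point_def) (simp add: yx inner_diff_right)
          ultimately show False using notin by (metis imageI)
        qed
        moreover have "a = h (\<phi> x)" using x by (simp add: h_def vec_eq_iff forall_2 \<phi>c)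
        ultimately show "a \<in> h ` (+) k ` f ` S" unfolding img[symmetric] by blast
      qed
      moreover have "bounded (h ` (+) k ` f ` S)"
        using S lin \<open>linear h\<close>
        by (intro bounded_translation bounded_linear_image) (simp_all add: linear_conv_bounded_linear)
      ultimately show ?thesis by (rule bounded_subset[rotated])
    qed
  qed
  ultimately show ?thesis unfolding placeable_in_first_trimming_position_def by blast
qed

section \<open>Placing polyhedra whose projection is a strip or a sector\<close>

lemma common_orthogonal_vector:
  fixes a b :: "real^3"
  obtains w where "w \<noteq> 0" "a \<bullet> w = 0" "b \<bullet> w = 0"
proof -
  \<comment> \<open>The two vectors may be dependent, so a dimension count is used instead of their
    cross product.\<close>
  have "dim {a, b} \<le> card {a, b}" by (intro dim_le_card') simp
  also have "\<dots> \<le> 2" by (simp add: card_insert_if)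
  finally have "dim {a, b} < DIM(real^3)" by simp
  then obtain w where "w \<noteq> 0" "\<And>y. y \<in> span {a, b} \<Longrightarrow> orthogonal w y"
    using orthogonal_to_subspace_exists by blast
  then show ?thesis
    by (intro that[of w]) (auto simp: orthogonal_def inner_commute span_base)
qed

lemma bounded_Int_line:
  fixes S :: "'a::euclidean_space set"
  assumes S: "closed S" "convex S"
    and g: "\<And>d. d \<in> recession_cone S \<Longrightarrow> d \<noteq> 0 \<Longrightarrow> 0 < g \<bullet> d" and gw: "g \<bullet> w = 0"
  shows "bounded (S \<inter> range (\<lambda>t. x + t *\<^sub>R w))"
  by (rule bounded_subset[OF bounded_Int_sublevel[OF S g, of "g \<bullet> x"]]) (auto simp: inner_add_right gw)

text \<open>Facets of polyhedra are exposed; a zero normal would expose only the empty set or all of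
  \<open>K\<close>.\<close>

lemma facet_supporting_hyperplane:
  fixes K :: "'a::euclidean_space set"
  assumes K: "polyhedron K" and F: "F facet_of K"
  obtains n c where "n \<noteq> 0" "K \<subseteq> {x. n \<bullet> x \<le> c}" "F = K \<inter> {x. n \<bullet> x = c}"
proof -
  obtain n c where nc: "K \<subseteq> {x. n \<bullet> x \<le> c}" "F = K \<inter> {x. n \<bullet> x = c}"
    using exposed_face_of_polyhedron[OF K, of F] F
    unfolding exposed_face_of_def facet_of_def by blast
  have "F \<noteq> {}" "F \<noteq> K" using F by (auto simp: facet_of_def)
  then have "n \<noteq> 0" using nc(2) by auto
  with nc show ?thesis by (intro that)
qed

text \<open>Here \<open>h\<close> measures the position across the strip and \<open>r\<close> runs
  along it. Far out, a point has \<open>\<alpha>\<close> in the unit interval and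
  \<open>\<beta> \<ge> 0\<close>, so its shift along \<open>w\<close> lies on a ray in direction
  \<open>r\<close> from the segment between \<open>p\<close> and \<open>q\<close>.\<close>

lemma placeable_strip:
  fixes K :: "(real^3) set"
  assumes K: "polyhedron K" "aff_dim K = 3" and F: "F facet_of K"
    and n: "n \<noteq> 0" "K \<subseteq> {x. n \<bullet> x \<le> c}" "F = K \<inter> {x. n \<bullet> x = c}"
    and g: "\<And>d. d \<in> recession_cone K \<Longrightarrow> d \<noteq> 0 \<Longrightarrow> 0 < g \<bullet> d"
    and w: "w \<noteq> 0" "n \<bullet> w = 0" "g \<bullet> w = 0"
    and r: "r \<in> recession_cone K" "r \<noteq> 0"
    and h: "h \<noteq> 0" "h \<bullet> w = 0" "\<And>d. d \<in> recession_cone K \<Longrightarrow> h \<bullet> d = 0"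
  shows "placeable_in_first_trimming_position K F"
proof -
  have clo: "closed K" and conv: "convex K"
    using K polyhedron_imp_closed polyhedron_imp_convex by auto
  have ne: "K \<noteq> {}" using K(2) by auto
  obtain p where p: "p \<in> K" "\<And>x. x \<in> K \<Longrightarrow> h \<bullet> p \<le> h \<bullet> x"
    using polyhedron_attains_min[OF K(1) ne g, of h] h(3) by force
  obtain q where q: "q \<in> K" "\<And>x. x \<in> K \<Longrightarrow> h \<bullet> x \<le> h \<bullet> q"
    using polyhedron_attains_min[OF K(1) ne g, of "- h"] h(3) by force
  have pq: "h \<bullet> p < h \<bullet> q"
  proof (rule ccontr)
    assume "\<not> h \<bullet> p < h \<bullet> q"
    then have "K \<subseteq> {x. h \<bullet> x = h \<bullet> p}" using p(2) q(2) by force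
    then have "aff_dim K \<le> aff_dim {x. h \<bullet> x = h \<bullet> p}" by (rule aff_dim_subset)
    then show False using K(2) h(1) by simp
  qed
  have gr: "0 < g \<bullet> r" using g r by blast
  have hr: "h \<bullet> r = 0" using h(3) r by blast
  have Fn: "F \<subseteq> {x. n \<bullet> x = c}" using n(3) by blast
  show ?thesis
  proof (rule placeable_criterion[OF K F n(1) Fn n(2) w(2), where s = "q - p" and r = r and q = p])
    \<comment> \<open>Beyond this level the term \<open>\<alpha> * (g \<bullet> (q - p))\<close>
      cannot account for the value of \<open>g\<close>, which forces \<open>\<beta>\<close> to be
      positive.\<close>
    show "bounded (K \<inter> {x. g \<bullet> x \<le> g \<bullet> p + \<bar>g \<bullet> (q - p)\<bar>})"
      using clo conv g by (rule bounded_Int_sublevel)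
    show "bounded (K \<inter> range (\<lambda>t. x + t *\<^sub>R w))" for x
      using clo conv g w(3) by (rule bounded_Int_line)
  next
    fix \<alpha> \<beta> \<gamma> assume 0: "\<alpha> *\<^sub>R (q - p) + \<beta> *\<^sub>R r + \<gamma> *\<^sub>R w = 0" (is "?v = 0")
    have "h \<bullet> ?v = \<alpha> * (h \<bullet> q - h \<bullet> p)"
      by (simp add: inner_add_right inner_diff_right hr h(2))
    then have "\<alpha> = 0" using pq 0 by simp
    moreover have "g \<bullet> ?v = \<beta> * (g \<bullet> r)"
      using \<open>\<alpha> = 0\<close> by (simp add: inner_add_right w(3))
    then have "\<beta> = 0" using gr 0 by simp
    ultimately show "\<alpha> = 0 \<and> \<beta> = 0 \<and> \<gamma> = 0" using 0 w(1) by simp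
  next
    fix \<alpha> \<beta> \<gamma>
    assume "p + (\<alpha> *\<^sub>R (q - p) + \<beta> *\<^sub>R r + \<gamma> *\<^sub>R w)
      \<in> K - K \<inter> {x. g \<bullet> x \<le> g \<bullet> p + \<bar>g \<bullet> (q - p)\<bar>}" (is "?x \<in> _")
    then have x: "?x \<in> K" "g \<bullet> p + \<bar>g \<bullet> (q - p)\<bar> < g \<bullet> ?x" by auto
    have hx: "h \<bullet> ?x = h \<bullet> p + \<alpha> * (h \<bullet> q - h \<bullet> p)"
      by (simp add: inner_add_right inner_diff_right hr h(2))
    have "0 \<le> \<alpha> * (h \<bullet> q - h \<bullet> p)" "\<alpha> * (h \<bullet> q - h \<bullet> p) \<le> 1 * (h \<bullet> q - h \<bullet> p)"
      using p(2)[OF x(1)] q(2)[OF x(1)] hx by simp_all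
    then have \<alpha>: "0 \<le> \<alpha>" "\<alpha> \<le> 1" using pq by (auto simp: zero_le_mult_iff mult_le_cancel_right)
    have "\<alpha> * (g \<bullet> (q - p)) \<le> 1 * \<bar>g \<bullet> (q - p)\<bar>"
      using \<alpha> by (meson abs_ge_self abs_ge_zero mult_left_mono mult_right_mono order_trans)
    moreover have "g \<bullet> ?x = g \<bullet> p + \<alpha> * (g \<bullet> (q - p)) + \<beta> * (g \<bullet> r)"
      by (simp only: inner_add_right inner_scaleR_right w(3))
    ultimately have "0 < \<beta> * (g \<bullet> r)" using x(2) by linarith
    then have "0 \<le> \<beta>" using gr by (simp add: zero_less_mult_iff)
    have "(1 - \<alpha>) *\<^sub>R p + \<alpha> *\<^sub>R q \<in> K" using \<alpha> p(1) q(1) conv by (intro convexD) auto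
    then have "(1 - \<alpha>) *\<^sub>R p + \<alpha> *\<^sub>R q + \<beta> *\<^sub>R r \<in> K" by (rule recession_coneD[OF r(1) _ \<open>0 \<le> \<beta>\<close>])
    moreover have "(1 - \<alpha>) *\<^sub>R p + \<alpha> *\<^sub>R q + \<beta> *\<^sub>R r = p + (\<alpha> *\<^sub>R (q - p) + \<beta> *\<^sub>R r)"
      by (simp add: algebra_simps)
    ultimately show "p + (\<alpha> *\<^sub>R (q - p) + \<beta> *\<^sub>R r) \<in> K" by simp
  qed
qed

text \<open>The bounds on \<open>f\<close> and \<open>n\<close> give \<open>0 \<le> \<alpha>\<close>
  and \<open>\<beta>0 \<le> \<beta>\<close>. If \<open>0 \<le> \<beta>\<close>, the shifted point is
  reached from \<open>q\<close> by recession directions; otherwise \<open>\<alpha>\<close> is large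
  far out, and it is reached from the facet \<open>F\<close>.\<close>

lemma placeable_sector:
  fixes K :: "(real^3) set"
  assumes K: "polyhedron K" "aff_dim K = 3" and F: "F facet_of K"
    and n: "n \<noteq> 0" "K \<subseteq> {x. n \<bullet> x \<le> c}" "F = K \<inter> {x. n \<bullet> x = c}"
    and g: "\<And>d. d \<in> recession_cone K \<Longrightarrow> d \<noteq> 0 \<Longrightarrow> 0 < g \<bullet> d"
    and w: "w \<noteq> 0" "n \<bullet> w = 0" "g \<bullet> w = 0"
    and u: "u \<in> recession_cone F" and v: "v \<in> recession_cone F"
    and indep: "\<And>\<alpha> \<beta>. \<alpha> *\<^sub>R u + \<beta> *\<^sub>R v = 0 \<Longrightarrow> \<alpha> = 0 \<and> \<beta> = 0"
    and r: "r \<in> recession_cone K" "n \<bullet> r < 0"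
    and slope: "\<And>d. d \<in> recession_cone K \<Longrightarrow> n \<bullet> r / (g \<bullet> r) * (g \<bullet> d) \<le> n \<bullet> d"
  shows "placeable_in_first_trimming_position K F"
proof -
  have clo: "closed K" and conv: "convex K"
    using K polyhedron_imp_closed polyhedron_imp_convex by auto
  have ne: "K \<noteq> {}" using K(2) by auto
  have F': "F \<subseteq> K" "F \<noteq> {}" using F by (auto simp: facet_of_def face_of_imp_subset)
  have uvK: "u \<in> recession_cone K" "v \<in> recession_cone K"
    using u v recession_cone_mono[OF clo conv F'] by auto
  obtain p where p: "p \<in> F" using F' by blast
  have nuv: "n \<bullet> u = 0" "n \<bullet> v = 0"
    using recession_cone_Int_hyperplane u v p unfolding n(3) by blast+
  define s where "s = u + v"
  have sK: "s \<in> recession_cone K" unfolding s_def using uvK by (rule recession_cone_add)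
  have "s \<noteq> 0" using indep[of 1 1] by (auto simp: s_def)
  then have gs: "0 < g \<bullet> s" using g sK by blast
  have ns: "n \<bullet> s = 0" by (simp add: s_def inner_add_right nuv)
  have "r \<noteq> 0" using r(2) by auto
  then have gr: "0 < g \<bullet> r" using g r by blast
  define \<mu> where "\<mu> = n \<bullet> r / (g \<bullet> r)"
  \<comment> \<open>This functional vanishes on \<open>r\<close> and \<open>w\<close> and is
    positive on \<open>s\<close>, so it reads off \<open>\<alpha>\<close>; its minimiser
    \<open>q\<close> fixes the side of the sector.\<close>
  define f where "f = n - \<mu> *\<^sub>R g"
  have "\<mu> < 0" using r gr by (simp add: \<mu>_def divide_neg_pos)
  have fr: "f \<bullet> r = 0" using gr by (simp add: f_def \<mu>_def inner_diff_left)
  have fw: "f \<bullet> w = 0" by (simp add: f_def inner_diff_left w)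
  have fs: "0 < f \<bullet> s" using gs \<open>\<mu> < 0\<close> by (simp add: f_def inner_diff_left ns mult_neg_pos)
  have "0 \<le> f \<bullet> d" if "d \<in> recession_cone K" for d
    using slope[OF that] by (simp add: f_def \<mu>_def inner_diff_left)
  then obtain q where q: "q \<in> K" "\<And>x. x \<in> K \<Longrightarrow> f \<bullet> q \<le> f \<bullet> x"
    using polyhedron_attains_min[OF K(1) ne g] by blast
  \<comment> \<open>The line through \<open>q\<close> in direction \<open>r\<close> meets the plane
    of \<open>F\<close> at this parameter.\<close>
  define \<beta>0 where "\<beta>0 = (c - n \<bullet> q) / (n \<bullet> r)"
  have \<beta>0: "n \<bullet> q + \<beta>0 * (n \<bullet> r) = c" using r(2) by (simp add: \<beta>0_def)
  obtain a b where ab: "q + \<beta>0 *\<^sub>R r - p = a *\<^sub>R u + b *\<^sub>R v"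
  proof -
    have "\<alpha> = 0 \<and> \<beta> = 0 \<and> \<gamma> = 0" if "\<alpha> *\<^sub>R u + \<beta> *\<^sub>R v + \<gamma> *\<^sub>R n = 0" for \<alpha> \<beta> \<gamma>
    proof -
      have "n \<bullet> (\<alpha> *\<^sub>R u + \<beta> *\<^sub>R v + \<gamma> *\<^sub>R n) = \<gamma> * (n \<bullet> n)" by (simp add: inner_add_right nuv)
      then have "\<gamma> = 0" using that n(1) by simp
      then show ?thesis using that indep[of \<alpha> \<beta>] by simp
    qed
    then obtain a b k where abk: "q + \<beta>0 *\<^sub>R r - p = a *\<^sub>R u + b *\<^sub>R v + k *\<^sub>R n"
      using basis3_coordinates[of u v n "q + \<beta>0 *\<^sub>R r - p"] by blast
    have "n \<bullet> (q + \<beta>0 *\<^sub>R r - p) = 0"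
      using p \<beta>0 by (simp add: n(3) inner_add_right inner_diff_right)
    then have "k = 0" unfolding abk using n(1) by (simp add: inner_add_right nuv)
    with abk show ?thesis by (intro that) simp
  qed
  \<comment> \<open>For \<open>\<alpha>\<close> above \<open>A\<close>, both
    \<open>a + \<alpha>\<close> and \<open>b + \<alpha>\<close> are nonnegative.\<close>
  define A where "A = \<bar>a\<bar> + \<bar>b\<bar>"
  have Fn: "F \<subseteq> {x. n \<bullet> x = c}" using n(3) by blast
  show ?thesis
  proof (rule placeable_criterion[OF K F n(1) Fn n(2) w(2), where s = s and r = r and q = q])
    \<comment> \<open>Beyond this level a negative \<open>\<beta>\<close> forces
      \<open>A < \<alpha>\<close>.\<close>
    show "bounded (K \<inter> {x. g \<bullet> x \<le> g \<bullet> q + A * (g \<bullet> s)})"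
      using clo conv g by (rule bounded_Int_sublevel)
    show "bounded (K \<inter> range (\<lambda>t. x + t *\<^sub>R w))" for x
      using clo conv g w(3) by (rule bounded_Int_line)
  next
    fix \<alpha> \<beta> \<gamma> assume 0: "\<alpha> *\<^sub>R s + \<beta> *\<^sub>R r + \<gamma> *\<^sub>R w = 0" (is "?v = 0")
    have "n \<bullet> ?v = \<beta> * (n \<bullet> r)" by (simp add: inner_add_right ns w)
    then have "\<beta> = 0" using r(2) 0 by simp
    moreover have "g \<bullet> ?v = \<alpha> * (g \<bullet> s)"
      using \<open>\<beta> = 0\<close> by (simp add: inner_add_right w(3))
    then have "\<alpha> = 0" using gs 0 by simp
    ultimately show "\<alpha> = 0 \<and> \<beta> = 0 \<and> \<gamma> = 0" using 0 w(1) by simp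
  next
    fix \<alpha> \<beta> \<gamma>
    assume "q + (\<alpha> *\<^sub>R s + \<beta> *\<^sub>R r + \<gamma> *\<^sub>R w) \<in> K - K \<inter> {x. g \<bullet> x \<le> g \<bullet> q + A * (g \<bullet> s)}" (is "?x \<in> _")
    then have x: "?x \<in> K" "g \<bullet> q + A * (g \<bullet> s) < g \<bullet> ?x" by auto
    have "f \<bullet> ?x = f \<bullet> q + \<alpha> * (f \<bullet> s)" by (simp add: inner_add_right fr fw)
    then have "0 \<le> \<alpha> * (f \<bullet> s)" using q(2)[OF x(1)] by simp
    then have \<alpha>: "0 \<le> \<alpha>" using fs by (simp add: zero_le_mult_iff)
    have "n \<bullet> ?x = n \<bullet> q + \<beta> * (n \<bullet> r)" by (simp add: inner_add_right ns w)
    then have "\<beta> * (n \<bullet> r) \<le> \<beta>0 * (n \<bullet> r)" using n(2) x(1) \<beta>0 by force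
    then have \<beta>: "\<beta>0 \<le> \<beta>" using r(2) by (simp add: mult_le_cancel_right)
    show "q + (\<alpha> *\<^sub>R s + \<beta> *\<^sub>R r) \<in> K"
    proof (cases "0 \<le> \<beta>")
      case True
      then have "q + \<alpha> *\<^sub>R s + \<beta> *\<^sub>R r \<in> K"
        using \<alpha> q(1) sK r(1) by (intro recession_coneD)
      then show ?thesis by (simp add: add.assoc)
    next
      case False
      have "g \<bullet> ?x = g \<bullet> q + \<alpha> * (g \<bullet> s) + \<beta> * (g \<bullet> r)" by (simp add: inner_add_right w)
      moreover have "\<beta> * (g \<bullet> r) < 0" using False gr by (simp add: mult_neg_pos)
      ultimately have "A * (g \<bullet> s) < \<alpha> * (g \<bullet> s)" using x(2) by linarith
      then have "A < \<alpha>" using gs by (simp add: mult_less_cancel_right)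
      then have "0 \<le> a + \<alpha>" "0 \<le> b + \<alpha>" by (auto simp: A_def)
      \<comment> \<open>From \<open>p\<close> in \<open>F\<close>, go to the point
        \<open>q + \<beta>0 r + \<alpha> s\<close> in the plane of \<open>F\<close>, then along
        \<open>r\<close>; all coefficients are nonnegative.\<close>
      then have "p + (a + \<alpha>) *\<^sub>R u + (b + \<alpha>) *\<^sub>R v + (\<beta> - \<beta>0) *\<^sub>R r \<in> K"
        using \<beta> p F' uvK r(1) by (intro recession_coneD) auto
      also have "p + (a + \<alpha>) *\<^sub>R u + (b + \<alpha>) *\<^sub>R v + (\<beta> - \<beta>0) *\<^sub>R r
          = p + (a *\<^sub>R u + b *\<^sub>R v) + \<alpha> *\<^sub>R s + (\<beta> - \<beta>0) *\<^sub>R r"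
        by (simp add: s_def algebra_simps)
      also have "\<dots> = q + (\<alpha> *\<^sub>R s + \<beta> *\<^sub>R r)"
        unfolding ab[symmetric] by (simp add: algebra_simps)
      finally show ?thesis .
    qed
  qed
qed

section \<open>Choosing between strip and sector for a given facet\<close>

theorem proposition1:
  fixes K :: "(real^3) set"
  assumes "polyhedron K" and "aff_dim K = 3" and "nondegenerate K" and "\<not> bounded K"
  shows "(\<forall>F. F facet_of K \<and>
              (\<exists>d e. d unbounded_edge_of F \<and> e unbounded_edge_of F \<and> \<not> parallel d e)
            \<longrightarrow> placeable_in_first_trimming_position K F)
       \<and> ((\<forall>d e. d unbounded_edge_of K \<and> e unbounded_edge_of K \<longrightarrow> parallel d e)
            \<longrightarrow> (\<exists>F. F facet_of K \<and> bounded F) \<and>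
                (\<forall>F. F facet_of K \<longrightarrow> placeable_in_first_trimming_position K F))"
proof (intro conjI impI allI; (elim conjE exE)?)
  fix F d e
  assume F: "F facet_of K" and d: "d unbounded_edge_of F" and e: "e unbounded_edge_of F"
    and npar: "\<not> parallel d e"
  have clo: "closed K" and conv: "convex K"
    using assms polyhedron_imp_closed polyhedron_imp_convex by auto
  obtain g where g: "\<And>d. d \<in> recession_cone K \<Longrightarrow> d \<noteq> 0 \<Longrightarrow> 0 < g \<bullet> d"
    using pointed_functional[OF assms(1,3)] by blast
  obtain n c where n: "n \<noteq> 0" "K \<subseteq> {x. n \<bullet> x \<le> c}" "F = K \<inter> {x. n \<bullet> x = c}"
    using facet_supporting_hyperplane[OF assms(1) F] .
  obtain w where w: "w \<noteq> 0" "n \<bullet> w = 0" "g \<bullet> w = 0"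
    using common_orthogonal_vector .
  have pF: "polyhedron F" using assms(1) F face_of_polyhedron_polyhedron facet_of_imp_face_of by blast
  obtain u where u: "u \<in> recession_cone d" "u \<in> recession_cone F" "u \<noteq> 0" "aff_dim d = 1"
    using unbounded_edge_recession[OF pF d] .
  obtain v where v: "v \<in> recession_cone e" "v \<in> recession_cone F" "v \<noteq> 0" "aff_dim e = 1"
    using unbounded_edge_recession[OF pF e] .
  have nonmult: "v \<noteq> k *\<^sub>R u" for k
    using parallel_iff_recession[OF u(4,1,3) v(4,1,3)] npar by blast
  have indep: "\<alpha> = 0 \<and> \<beta> = 0" if "\<alpha> *\<^sub>R u + \<beta> *\<^sub>R v = 0" for \<alpha> \<beta>
  proof -
    have "\<beta> = 0"
    proof (rule ccontr)
      assume "\<beta> \<noteq> 0"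
      have "\<beta> *\<^sub>R v = - (\<alpha> *\<^sub>R u)" using that by (simp add: eq_neg_iff_add_eq_0 add.commute)
      have "v = inverse \<beta> *\<^sub>R \<beta> *\<^sub>R v" using \<open>\<beta> \<noteq> 0\<close> by simp
      also have "\<dots> = (inverse \<beta> * - \<alpha>) *\<^sub>R u"
        unfolding \<open>\<beta> *\<^sub>R v = - (\<alpha> *\<^sub>R u)\<close> by simp
      finally have "v = (inverse \<beta> * - \<alpha>) *\<^sub>R u" .
      then show False using nonmult by blast
    qed
    then show ?thesis using that u(3) by simp
  qed
  have uK: "u \<in> recession_cone K"
    using recession_cone_mono[OF clo conv, of F] u(2) F facet_of_imp_subset
    by (metis facet_of_def subsetD)
  obtain r where r: "r \<in> recession_cone K" "r \<noteq> 0"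
    and slope: "\<And>d. d \<in> recession_cone K \<Longrightarrow> n \<bullet> r / (g \<bullet> r) * (g \<bullet> d) \<le> n \<bullet> d"
    using min_slope[OF clo uK u(3) g] by blast
  have nonpos: "n \<bullet> d \<le> 0" if d: "d \<in> recession_cone K" for d
  proof -
    obtain p where "p \<in> F" using F by (auto simp: facet_of_def)
    then have p: "p \<in> K" "n \<bullet> p = c" using n(3) by auto
    have "p + 1 *\<^sub>R d \<in> K" using d p(1) by (intro recession_coneD) auto
    then show ?thesis using n(2) p(2) by (auto simp: inner_add_right)
  qed
  show "placeable_in_first_trimming_position K F"
  \<comment> \<open>If the minimal slope is zero, \<open>n\<close> is both nonnegative and
    nonpositive on the cone, so \<open>n\<close> itself serves as \<open>h\<close> in the strip
    case.\<close>
  proof (cases "n \<bullet> r = 0")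
    case True
    have "n \<bullet> d = 0" if "d \<in> recession_cone K" for d
      using slope[OF that] nonpos[OF that] True by simp
    then show ?thesis
      using placeable_strip[OF assms(1,2) F n g w uK u(3) n(1) w(2)] by blast
  next
    case False
    then have "n \<bullet> r < 0" using nonpos[OF r(1)] by simp
    then show ?thesis
      using placeable_sector[OF assms(1,2) F n g w u(2) v(2) indep r(1) _ slope] by blast
  qed
next
  assume "\<forall>d e. d unbounded_edge_of K \<and> e unbounded_edge_of K \<longrightarrow> parallel d e"
  then have par: "\<And>d e. d unbounded_edge_of K \<Longrightarrow> e unbounded_edge_of K \<Longrightarrow> parallel d e" by blast
  have clo: "closed K" and conv: "convex K"
    using assms polyhedron_imp_closed polyhedron_imp_convex by auto
  have ne: "K \<noteq> {}" using assms(2) by auto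
  obtain g where g: "\<And>d. d \<in> recession_cone K \<Longrightarrow> d \<noteq> 0 \<Longrightarrow> 0 < g \<bullet> d"
    using pointed_functional[OF assms(1,3)] by blast
  obtain r where r: "r \<in> recession_cone K" "r \<noteq> 0"
    using unbounded_imp_recession[OF clo conv assms(4)] .
  have ray: "\<And>v. v \<in> recession_cone K \<Longrightarrow> \<exists>k. v = k *\<^sub>R r"
    using recession_ray_if_edges_parallel[OF assms(1) ne g par r] .
  show "\<exists>F. F facet_of K \<and> bounded F"
    using assms(1) ne g r ray by (rule bounded_facet_exists)
  fix F assume F: "F facet_of K"
  obtain n c where n: "n \<noteq> 0" "K \<subseteq> {x. n \<bullet> x \<le> c}" "F = K \<inter> {x. n \<bullet> x = c}"
    using facet_supporting_hyperplane[OF assms(1) F] .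
  obtain w where w: "w \<noteq> 0" "n \<bullet> w = 0" "g \<bullet> w = 0"
    using common_orthogonal_vector .
  \<comment> \<open>As the cone lies in the line spanned by \<open>r\<close>, orthogonality to
    \<open>r\<close> makes \<open>h\<close> vanish on all of it.\<close>
  obtain h where h: "h \<noteq> 0" "w \<bullet> h = 0" "r \<bullet> h = 0"
    using common_orthogonal_vector .
  have "h \<bullet> d = 0" if "d \<in> recession_cone K" for d
    using ray[OF that] h(3) by (auto simp: inner_commute)
  then show "placeable_in_first_trimming_position K F"
    using placeable_strip[OF assms(1,2) F n g w r h(1)] h(2) by (simp add: inner_commute)
qed

end
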